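(* Let $G$ be a regular dense-subgroup-separable abelian semitopological group. Then the following conditions are equivalent: (1) $G$ is $d$-independent; (2) for each subgroup $S$ of $G$ with $|S|<\mathfrak{c}$ and each nonempty open set $U$ in $G$, there is $x\in U\setminus\{e\}$ such that $\langle x\rangle\cap S=\{e\}$; (3) every nonempty open set in $G$ contains an independent subset of cardinality $\mathfrak{c}$.
   Context: All spaces are Hausdorff; $\mathfrak{c}=|\mathbb{R}|$; $e$ is the neutral element of $G$ (written additively); $\langle x\rangle$ is the cyclic subgroup generated by $x$. A semitopological group is a group with a topology for which all left and right translations are continuous. It is dense-subgroup-separable if each of its dense subgroups is separable. A nontrivial semitopological group $G$ is $d$-independent if for every subgroup $S$ of $G$ with $|S|<\mathfrak{c}$ there is a countable dense subgroup $H$ of $G$ such that $S\cap H=\{e\}$. A nonempty subset $B$ of an abelian group $G$ is independent if, for any pairwise distinct $b_1,\dots,b_m\in B$ and any integers $n_1,\dots,n_m$, the equality $n_1b_1+\cdots+n_mb_m=e$ implies $n_ib_i=e$ for every $i$. *)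

theory Defs
  imports
    "HOL-Algebra.Generated_Groups"
    "HOL-Algebra.FiniteProduct"
    "HOL-Analysis.Abstract_Topological_Spaces"
    "HOL-Library.Equipollence"
begin

text \<open>
  Groups are those of HOL-Algebra, hence written multiplicatively: the neutral element is
  \<open>\<one>\<^bsub>G\<^esub>\<close>, the integer multiple \<open>n b\<close> is \<open>b [^]\<^bsub>G\<^esub> n\<close> with \<open>n :: int\<close>, finite sums are
  \<open>finprod\<close>, and the cyclic subgroup generated by \<open>x\<close> is \<open>generate G {x}\<close>.
  \<open>|S| < \<cc>\<close> is \<open>S \<prec> (UNIV :: real set)\<close> and \<open>|B| = \<cc>\<close> is \<open>B \<approx> (UNIV :: real set)\<close>.
\<close>

locale semitopological_group = group G for G (structure) +
  fixes T :: "'a topology"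
  assumes topspace_eq: "topspace T = carrier G"
    and continuous_left_translation:
      "a \<in> carrier G \<Longrightarrow> continuous_map T T (\<lambda>x. a \<otimes> x)"
    and continuous_right_translation:
      "a \<in> carrier G \<Longrightarrow> continuous_map T T (\<lambda>x. x \<otimes> a)"

definition dense_in_space :: "'a topology \<Rightarrow> 'a set \<Rightarrow> bool" where
  "dense_in_space T D \<longleftrightarrow> D \<subseteq> topspace T \<and> T closure_of D = topspace T"

definition dense_subgroup_separable :: "('a, 'm) monoid_scheme \<Rightarrow> 'a topology \<Rightarrow> bool" where
  "dense_subgroup_separable G T \<longleftrightarrow>
     (\<forall>H. subgroup H G \<and> dense_in_space T H \<longrightarrow> separable_space (subtopology T H))"

definition d_independent :: "('a, 'm) monoid_scheme \<Rightarrow> 'a topology \<Rightarrow> bool" where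
  "d_independent G T \<longleftrightarrow>
     carrier G \<noteq> {\<one>\<^bsub>G\<^esub>} \<and>
     (\<forall>S. subgroup S G \<and> S \<prec> (UNIV :: real set) \<longrightarrow>
        (\<exists>H. subgroup H G \<and> countable H \<and> dense_in_space T H \<and> S \<inter> H = {\<one>\<^bsub>G\<^esub>}))"

text \<open>
  The pairwise distinct \<open>b\<^sub>1, \<dots>, b\<^sub>m\<close> are given as a finite subset \<open>F\<close> of \<open>B\<close>. The neutral element
  may belong to an independent set.
\<close>

definition independent_subset :: "('a, 'm) monoid_scheme \<Rightarrow> 'a set \<Rightarrow> bool" where
  "independent_subset G B \<longleftrightarrow>
     B \<noteq> {} \<and> B \<subseteq> carrier G \<and>
     (\<forall>F (n :: 'a \<Rightarrow> int). finite F \<and> F \<subseteq> B \<and>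
        (\<Otimes>\<^bsub>G\<^esub>b\<in>F. b [^]\<^bsub>G\<^esub> n b) = \<one>\<^bsub>G\<^esub> \<longrightarrow>
        (\<forall>b\<in>F. b [^]\<^bsub>G\<^esub> n b = \<one>\<^bsub>G\<^esub>))"

end

theory Submission
  imports Defs
begin

text \<open>
  Everything runs through the second condition: in every nonempty open set there is a point
  \<open>x \<noteq> \<one>\<close> whose cyclic subgroup meets a given small subgroup (one of cardinality less than the
  continuum) trivially. Below it is called \<open>opens_avoid_small_subgroups\<close>.

  Avoidance can be iterated. Well-order the reals so that proper initial segments are small, and
  let \<open>V i\<close> be a nonempty open set for each real \<open>i\<close>. A small set generates a small subgroup, so
  starting from a small subgroup \<open>S\<close> one can choose \<open>x i \<in> V i - {\<one>}\<close> by transfinite recursion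
  such that the cyclic subgroup of \<open>x i\<close> meets the subgroup generated by \<open>S\<close> and all earlier points
  only in \<open>\<one>\<close> (\<open>avoid_imp_triangular\<close>). Such a family is triangular: in a relation
  \<open>s \<otimes> \<Otimes> x i [^] n i = \<one>\<close> with \<open>s \<in> S\<close>, the factor with the last index lies in the subgroup
  generated by \<open>S\<close> and earlier points, so it is \<open>\<one>\<close>; deleting it and repeating, all factors are
  \<open>\<one>\<close> (\<open>triangular_relation_trivial\<close>). The two implications from avoidance are two choices of \<open>V\<close>.

  If \<open>V i\<close> is a fixed open set \<open>U\<close> and \<open>S\<close> is trivial, the points form an independent subset of \<open>U\<close>
  of cardinality of the continuum. If \<open>V\<close> runs through a \<open>\<pi>\<close>-base, the points generate a dense
  subgroup that meets \<open>S\<close> trivially; this subgroup is separable, hence contains a countable dense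
  subgroup, and \<open>d\<close>-independence follows. A \<open>\<pi>\<close>-base indexed by the reals exists because the
  group is separable and regular: the interiors of closures of subsets of a countable dense set
  form one.

  Conversely, a countable dense subgroup that meets \<open>S\<close> trivially has a point other than \<open>\<one>\<close> in
  each open \<open>U\<close>, unless \<open>U = {\<one>}\<close>. In that case the group is discrete, so its only dense subset is
  the whole group, which contradicts \<open>d\<close>-independence. Finally, if \<open>B\<close> is infinite, independent and larger
  than \<open>S\<close>, the cyclic subgroups of two distinct elements of \<open>B\<close> share only \<open>\<one>\<close>; so they cannot
  all meet \<open>S\<close> in more than \<open>\<one>\<close>, as there are too few points of \<open>S\<close>
  (\<open>large_independent_avoids_subgroup\<close>).
\<close>

unbundle cardinal_syntax

section \<open>Cardinality below the continuum\<close>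

lemma lesspoll_iff_ordLess: "A \<prec> B \<longleftrightarrow> |A| <o |B|"
proof -
  have le: "X \<lesssim> Y \<longleftrightarrow> |X| \<le>o |Y|" for X :: "'c set" and Y :: "'d set"
    unfolding lepoll_def by (rule card_of_ordLeq)
  show ?thesis
    unfolding lesspoll_def le eqpoll_iff_card_of_ordIso 
    by (auto simp: ordLeq_iff_ordLess_or_ordIso dest: not_ordLess_ordIso)
qed

lemma Un_lesspoll_infinite:
  assumes "infinite C" "A \<prec> C" "B \<prec> C"
  shows "A \<union> B \<prec> C"
  using assms unfolding lesspoll_iff_ordLess by (rule card_of_Un_ordLess_infinite)

lemma countable_lesspoll_real:
  assumes "countable A"
  shows "A \<prec> (UNIV :: real set)"
proof -
  have "\<not> (UNIV :: real set) \<lesssim> A"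
    using assms countable_lepoll uncountable_UNIV_real by blast
  then have "|A| <o |UNIV :: real set|"
    using card_of_ordLess[of "UNIV :: real set" A] by (simp add: lepoll_def)
  then show ?thesis by (simp add: lesspoll_iff_ordLess)
qed

text \<open>
  The cardinal order of the reals is a well-order of minimal type, so that every proper initial
  segment has smaller cardinality. The strict part is what transfinite recursion consumes.
\<close>

lemma real_wellorder_small_segments:
  obtains R :: "(real \<times> real) set"
  where "wf R" "trans R" "total R"
    and "\<And>i. {j. (j, i) \<in> R} \<prec> (UNIV :: real set)"
proof
  let ?r = "|UNIV :: real set|"
  have wo: "well_order_on UNIV ?r" by (rule card_of_well_order_on)
  then have lin: "linear_order_on UNIV ?r" and wf: "wf (?r - Id)"
    by (auto simp: well_order_on_def)
  show "wf (?r - Id)" by (rule wf)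
  have "trans ?r" "antisym ?r" "total ?r"
    using lin by (auto simp: linear_order_on_def partial_order_on_def preorder_on_def)
  then show "trans (?r - Id)" "total (?r - Id)"
    by (auto intro: trans_diff_Id)
  fix i
  have "|underS ?r i| <o ?r"
    by (rule card_of_underS) (simp_all add: card_of_card_order_on Field_card_of)
  moreover have "underS ?r i = {j. (j, i) \<in> ?r - Id}"
    by (auto simp: underS_def)
  ultimately show "{j. (j, i) \<in> ?r - Id} \<prec> (UNIV :: real set)"
    by (simp add: lesspoll_iff_ordLess)
qed

text \<open>
  At the first place \<open>n\<close> where two sets differ, one series gains \<open>1/3\<^sup>n\<close>, while the other can gain
  at most half of that from all later places.
\<close>

lemma ternary_series_inj:
  "inj (\<lambda>A :: nat set. \<Sum>k. if k \<in> A then (1/3 :: real) ^ k else 0)"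
proof -
  define h where "h A k = (if k \<in> A then (1/3 :: real) ^ k else 0)" for A :: "nat set" and k
  have geo: "summable (\<lambda>k. (1/3 :: real) ^ k)" by (rule summable_geometric) simp
  have sm: "summable (h A)" for A
    by (rule summable_comparison_test'[OF geo, of 0]) (simp add: h_def)
  have less: "suminf (h B) < suminf (h A)"
    if n: "n \<in> A" "n \<notin> B" and same: "\<And>k. k < n \<Longrightarrow> k \<in> A \<longleftrightarrow> k \<in> B" for A B n
  proof -
    have "suminf (h B) = (\<Sum>k. h B (k + Suc n)) + (\<Sum>k<Suc n. h B k)"
      by (rule suminf_split_initial_segment[OF sm])
    also have "(\<Sum>k. h B (k + Suc n)) \<le> (\<Sum>k. (1/3) ^ (k + Suc n))"
    proof (rule suminf_le)
      show "summable (\<lambda>k. h B (k + Suc n))" using sm by (rule summable_ignore_initial_segment)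
      show "summable (\<lambda>k. (1/3 :: real) ^ (k + Suc n))"
        using geo by (rule summable_ignore_initial_segment)
    qed (simp add: h_def)
    also have "(\<Sum>k. (1/3 :: real) ^ (k + Suc n)) = (1/3) ^ Suc n * (\<Sum>k. (1/3) ^ k)"
      using suminf_mult[OF geo, of "(1/3) ^ Suc n"] by (simp add: power_add mult.commute)
    also have "\<dots> = (1/3) ^ n / 2" by (simp add: suminf_geometric)
    also have "(\<Sum>k<Suc n. h B k) = (\<Sum>k<n. h A k)"
      using n same by (simp add: h_def)
    finally have "suminf (h B) \<le> (1/3) ^ n / 2 + (\<Sum>k<n. h A k)" by simp
    also have "\<dots> < (\<Sum>k<Suc n. h A k)" using n by (simp add: h_def)
    also have "\<dots> \<le> suminf (h A)"
      by (rule sum_le_suminf[OF sm]) (auto simp: h_def)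
    finally show ?thesis .
  qed
  have "inj (\<lambda>A. suminf (h A))"
  proof (rule injI, rule ccontr)
    fix A B assume eq: "suminf (h A) = suminf (h B)" and "A \<noteq> B"
    then have ex: "\<exists>n. (n \<in> A) \<noteq> (n \<in> B)" by blast
    define n where "n = (LEAST n. (n \<in> A) \<noteq> (n \<in> B))"
    have "(n \<in> A) \<noteq> (n \<in> B)" using LeastI_ex[OF ex] by (simp add: n_def)
    moreover have "k \<in> A \<longleftrightarrow> k \<in> B" if "k < n" for k
      using not_less_Least[of k "\<lambda>n. (n \<in> A) \<noteq> (n \<in> B)"] that by (auto simp: n_def)
    ultimately show False using less[of n A B] less[of n B A] eq by auto
  qed
  then show ?thesis unfolding h_def .
qed

lemma surj_real_nat_sets:
  obtains \<phi> :: "real \<Rightarrow> nat set" where "surj \<phi>"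
  by (rule that[OF inj_imp_surj_inv[OF ternary_series_inj]])

section \<open>Regular separable spaces\<close>

text \<open>
  A nonempty open set contains, by regularity, the closure of a nonempty open \<open>P\<close>. For a countable
  dense set \<open>D\<close> the closure of \<open>P\<close> is that of \<open>P \<inter> D\<close>, so it is determined by a subset of \<open>D\<close>, and
  there are at most continuum many of these.
\<close>

lemma regular_separable_pi_base:
  assumes "regular_space T" "separable_space T" "topspace T \<noteq> {}"
  obtains V :: "real \<Rightarrow> 'a set"
  where "\<And>i. openin T (V i)" "\<And>i. V i \<noteq> {}"
    and "\<And>U. openin T U \<Longrightarrow> U \<noteq> {} \<Longrightarrow> \<exists>i. V i \<subseteq> U"
proof -
  obtain D where D: "countable D" "D \<subseteq> topspace T" "T closure_of D = topspace T"
    using assms(2) unfolding separable_space_def by blast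
  obtain \<phi> :: "real \<Rightarrow> nat set" where \<phi>: "surj \<phi>" by (rule surj_real_nat_sets)
  define W where "W i = T interior_of (T closure_of (from_nat_into D ` \<phi> i \<inter> D))" for i
  \<comment> \<open>A nowhere dense subset of \<open>D\<close> gives \<open>W i = {}\<close>; the whole space is a harmless substitute.\<close>
  define V where "V i = (if W i = {} then topspace T else W i)" for i
  have "\<exists>i. V i \<subseteq> U" if U: "openin T U" "U \<noteq> {}" for U
  proof -
    obtain x where "x \<in> U" using U by blast
    then obtain P C where P: "openin T P" "closedin T C" "x \<in> P" "P \<subseteq> C" "C \<subseteq> U"
      using assms(1) U unfolding neighbourhood_base_of_closedin[symmetric] neighbourhood_base_of
      by meson
    have "\<exists>N. from_nat_into D ` N \<inter> D = P \<inter> D"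
    proof
      show "from_nat_into D ` {n. from_nat_into D n \<in> P \<inter> D} \<inter> D = P \<inter> D"
        using subset_range_from_nat_into[OF D(1)] by blast
    qed
    then obtain i where i: "from_nat_into D ` \<phi> i \<inter> D = P \<inter> D"
      using surjD[OF \<phi>] by metis
    have "T closure_of (P \<inter> T closure_of D) = T closure_of P"
      using D(3) P(1) by (simp add: inf.absorb1 openin_subset)
    then have "T closure_of (P \<inter> D) = T closure_of P"
      using closure_of_openin_Int_closure_of[OF P(1), of D] by simp
    then have W: "W i = T interior_of (T closure_of P)" by (simp add: W_def i)
    have "P \<subseteq> W i"
      unfolding W using P(1) by (intro interior_of_maximal closure_of_subset openin_subset)
    moreover have "W i \<subseteq> U"
      unfolding W
      by (rule subset_trans[OF interior_of_subset subset_trans[OF closure_of_minimal[OF P(4,2)] P(5)]])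
    ultimately show ?thesis using P(3) by (auto simp: V_def)
  qed
  moreover have "openin T (V i)" "V i \<noteq> {}" for i
    using assms(3) by (auto simp: V_def W_def)
  ultimately show ?thesis using that by blast
qed

lemma dense_in_space_iff:
  "dense_in_space T D \<longleftrightarrow>
     D \<subseteq> topspace T \<and> (\<forall>U. openin T U \<and> U \<noteq> {} \<longrightarrow> D \<inter> U \<noteq> {})"
  unfolding dense_in_space_def dense_intersects_open ..

section \<open>Generated subgroups\<close>

context group
begin

text \<open>
  A generated subgroup is the union of the sets of words of length \<open>n\<close> in the generators and their
  inverses; each of these sets, and so their union, embeds in \<open>K\<close>. Bounding by an arbitrary infinite
  \<open>K\<close> treats countable and uncountable generating sets at once.
\<close>

lemma generate_lepoll_infinite:
  assumes A: "A \<subseteq> carrier G" and K: "infinite K" "A \<lesssim> K"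
  shows "generate G A \<lesssim> K"
proof -
  \<comment> \<open>The letters, with \<open>\<one>\<close> added, and \<open>W n\<close>, the products of \<open>n\<close> letters.\<close>
  define B where "B = insert \<one> (A \<union> m_inv G ` A)"
  define W where "W n = ((\<lambda>X. (\<lambda>(a, y). a \<otimes> y) ` (B \<times> X)) ^^ n) {\<one>}" for n
  have W0: "W 0 = {\<one>}" and WS: "W (Suc n) = (\<lambda>(a, y). a \<otimes> y) ` (B \<times> W n)" for n
    by (simp_all add: W_def)
  have B: "B \<subseteq> carrier G" using A by (auto simp: B_def)
  have Wc: "W n \<subseteq> carrier G" for n
    using B by (induction n) (auto simp: W0 WS)
  have Bc: "B \<subseteq> W (Suc 0)" using B by (force simp: W0 WS)
  have mult: "a \<otimes> b \<in> W (m + n)" if "a \<in> W m" "b \<in> W n" for a b m n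
    using that(1)
  proof (induction m arbitrary: a)
    case 0 then show ?case using that(2) subsetD[OF Wc that(2)] by (simp add: W0)
  next
    case (Suc m)
    then obtain c y where c: "c \<in> B" "y \<in> W m" "a = c \<otimes> y" by (auto simp: WS)
    have "c \<otimes> (y \<otimes> b) \<in> W (Suc (m + n))"
      using Suc.IH[OF c(2)] c(1) by (auto simp: WS)
    then show ?case using c that(2) B Wc by (simp add: m_assoc subset_iff)
  qed
  have "x \<in> (\<Union>n. W n)" if "x \<in> generate G A" for x
    using that
  proof induction
    case one then show ?case using W0 by blast
  next
    case (incl h) then show ?case using Bc by (auto simp: B_def)
  next
    case (inv h) then show ?case using Bc by (auto simp: B_def)
  next
    case (eng h1 h2) then show ?case using mult by blast
  qed
  then have sub: "generate G A \<subseteq> (\<Union>n. W n)" by blast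
  have KK: "|K \<times> K| \<le>o |K|"
    using card_of_Times_same_infinite[OF K(1)] by (rule ordIso_imp_ordLeq)
  have AK: "|A| \<le>o |K|" using K(2) card_of_ordLeq[of A K] by (simp add: lepoll_def)
  have iA: "|m_inv G ` A| \<le>o |K|" using card_of_image AK by (rule ordLeq_transitive)
  have "|A \<union> m_inv G ` A| \<le>o |K|"
    using card_of_Un_ordLeq_infinite_Field[OF _ AK iA card_of_Card_order] K(1)
    by (simp add: Field_card_of)
  moreover have "|{\<one>}| \<le>o |K|" using K(1) by (metis card_of_singl_ordLeq finite.emptyI)
  ultimately have BK: "|B| \<le>o |K|"
    using card_of_Un_ordLeq_infinite_Field[OF _ _ _ card_of_Card_order, of K "{\<one>}" "A \<union> m_inv G ` A"] K(1)
    by (simp add: B_def Field_card_of)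
  have WK: "|W n| \<le>o |K|" for n
  proof (induction n)
    case 0 then show ?case using \<open>|{\<one>}| \<le>o |K|\<close> by (simp add: W0)
  next
    case (Suc n)
    have "|B \<times> W n| \<le>o |K|"
      using card_of_Times_mono1[OF BK, of "W n"] card_of_Times_mono2[OF Suc, of K] KK
      by (meson ordLeq_transitive)
    then show ?case unfolding WS using card_of_image ordLeq_transitive by blast
  qed
  have "|UNIV :: nat set| \<le>o |K|" using K(1) infinite_iff_card_of_nat by blast
  then have "|\<Union>n. W n| \<le>o |K|"
    using card_of_UNION_ordLeq_infinite[OF K(1)] WK by blast
  then have "|generate G A| \<le>o |K|"
    using card_of_mono1[OF sub] ordLeq_transitive by blast
  then show ?thesis using card_of_ordLeq[of "generate G A" K] by (simp add: lepoll_def)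
qed

lemma countable_generate:
  assumes "A \<subseteq> carrier G" "countable A"
  shows "countable (generate G A)"
proof -
  have "A \<lesssim> (UNIV :: nat set)"
    using assms(2) by (auto simp: countable_def lepoll_def)
  then have "generate G A \<lesssim> (UNIV :: nat set)"
    by (intro generate_lepoll_infinite assms(1)) simp
  then show ?thesis by (rule countable_lepoll[OF countableI_type])
qed

lemma generate_lesspoll_real:
  assumes "A \<subseteq> carrier G" "A \<prec> (UNIV :: real set)"
  shows "generate G A \<prec> (UNIV :: real set)"
proof (cases "finite A")
  case True
  then show ?thesis
    by (intro countable_lesspoll_real countable_generate assms(1) countable_finite)
next
  case False
  then show ?thesis
    by (intro lesspoll_trans1[OF generate_lepoll_infinite[OF assms(1)] assms(2)]) simp_all
qed

end

section \<open>Triangular families\<close>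

lemma finite_total_trans_max:
  assumes "finite F" "F \<noteq> {}" "trans R" "total R"
  shows "\<exists>m\<in>F. \<forall>i\<in>F. i \<noteq> m \<longrightarrow> (i, m) \<in> R"
  using assms(1,2)
proof (induction rule: finite_ne_induct)
  case (singleton a) then show ?case by simp
next
  case (insert a F)
  then obtain m where m: "m \<in> F" "\<forall>i\<in>F. i \<noteq> m \<longrightarrow> (i, m) \<in> R" by blast
  then have "(a, m) \<in> R \<or> (m, a) \<in> R"
    using insert.hyps assms(4) by (metis UNIV_I total_on_def)
  then show ?case
  proof
    assume "(a, m) \<in> R"
    then show ?thesis using m by (intro bexI[of _ m]) auto
  next
    assume "(m, a) \<in> R"
    then show ?thesis using m assms(3) by (intro bexI[of _ a]) (auto dest: transD)
  qed
qed

context comm_group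
begin

lemma generate_image_finprod:
  fixes x :: "'i \<Rightarrow> 'a"
  assumes x: "\<And>i. i \<in> I \<Longrightarrow> x i \<in> carrier G" and "g \<in> generate G (x ` I)"
  obtains F and n :: "'i \<Rightarrow> int"
  where "finite F" "F \<subseteq> I" "g = (\<Otimes>i\<in>F. x i [^] n i)"
proof -
  have "\<exists>F (n :: 'i \<Rightarrow> int). finite F \<and> F \<subseteq> I \<and> g = (\<Otimes>i\<in>F. x i [^] n i)"
    using assms(2)
  proof induction
    case one
    show ?case by (rule exI[of _ "{}"]) simp
  next
    case (incl h)
    then obtain i where "i \<in> I" "h = x i" by blast
    then show ?case
      by (intro exI[of _ "{i}"] exI[of _ "\<lambda>_. 1"]) (simp add: x int_pow_1)
  next
    case (inv h)
    then obtain i where "i \<in> I" "h = x i" by blast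
    then show ?case
      by (intro exI[of _ "{i}"] exI[of _ "\<lambda>_. - 1"]) (simp add: x int_pow_neg int_pow_1)
  next
    case (eng h1 h2)
    then obtain F1 F2 and n1 n2 :: "'i \<Rightarrow> int"
      where 1: "finite F1" "F1 \<subseteq> I" "h1 = (\<Otimes>i\<in>F1. x i [^] n1 i)"
        and 2: "finite F2" "F2 \<subseteq> I" "h2 = (\<Otimes>i\<in>F2. x i [^] n2 i)"
      by blast
    \<comment> \<open>Exponents extended by \<open>0\<close> bring both products to the common index set \<open>F1 \<union> F2\<close>.\<close>
    define m1 where "m1 i = (if i \<in> F1 then n1 i else 0)" for i
    define m2 where "m2 i = (if i \<in> F2 then n2 i else 0)" for i
    have "h1 = (\<Otimes>i\<in>F1 \<union> F2. x i [^] m1 i)"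
      unfolding 1 using 1 2 x
      by (intro finprod_mono_neutral_cong_left) (auto simp: m1_def subset_iff)
    moreover have "h2 = (\<Otimes>i\<in>F1 \<union> F2. x i [^] m2 i)"
      unfolding 2 using 1 2 x
      by (intro finprod_mono_neutral_cong_left) (auto simp: m2_def subset_iff)
    ultimately have "h1 \<otimes> h2 = (\<Otimes>i\<in>F1 \<union> F2. x i [^] m1 i \<otimes> x i [^] m2 i)"
      using 1(2) 2(2) x by (subst finprod_multf) (auto simp: subset_iff)
    also have "\<dots> = (\<Otimes>i\<in>F1 \<union> F2. x i [^] (m1 i + m2 i))"
      using 1 2 x by (intro finprod_cong') (auto simp: int_pow_mult subset_iff)
    finally show ?case using 1 2 by (intro exI[of _ "F1 \<union> F2"] exI[of _ "\<lambda>i. m1 i + m2 i"]) simp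
  qed
  then show ?thesis using that by blast
qed

lemma subgroup_finprod_closed:
  assumes "subgroup H G" and "\<And>i. i \<in> F \<Longrightarrow> f i \<in> H"
  shows "(\<Otimes>i\<in>F. f i) \<in> H"
  using assms(2)
proof (induction F rule: infinite_finite_induct)
  case (insert i F)
  then have "f \<in> F \<rightarrow> carrier G" "f i \<in> carrier G"
    using subgroup.mem_carrier[OF assms(1)] by auto
  then show ?case
    using insert subgroup.m_closed[OF assms(1)] by simp
qed (use subgroup.one_closed[OF assms(1)] in auto)

text \<open>
  The hypothesis \<open>step\<close> says that the family is triangular over \<open>S\<close>. Solving a relation for the
  factor with the \<open>R\<close>-greatest index puts that factor into the subgroup generated by \<open>S\<close> and the
  earlier members, where only \<open>\<one>\<close> is possible; the relation gets shorter.
\<close>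

lemma triangular_relation_trivial:
  fixes R :: "('i \<times> 'i) set" and n :: "'i \<Rightarrow> int"
  assumes R: "trans R" "total R" and S: "subgroup S G" and x: "\<And>i. x i \<in> carrier G"
    and step: "\<And>i. generate G {x i} \<inter> generate G (S \<union> x ` {j. (j, i) \<in> R}) = {\<one>}"
    and "finite F" "s \<in> S" "s \<otimes> (\<Otimes>i\<in>F. x i [^] n i) = \<one>"
  shows "\<forall>i\<in>F. x i [^] n i = \<one>"
  using assms(6,8)
proof (induction F rule: finite_psubset_induct)
  case (psubset F)
  show ?case
  proof (cases "F = {}")
    case False
    then obtain m where m: "m \<in> F" "\<forall>i\<in>F. i \<noteq> m \<longrightarrow> (i, m) \<in> R"
      using finite_total_trans_max[OF psubset.hyps False R] by blast
    let ?L = "generate G (S \<union> x ` {j. (j, m) \<in> R})"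
    let ?p = "\<Otimes>i\<in>F - {m}. x i [^] n i"
    have L: "subgroup ?L G"
      using x S by (intro generate_is_subgroup) (auto dest: subgroup.mem_carrier)
    have sc: "s \<in> carrier G" using S \<open>s \<in> S\<close> by (rule subgroup.mem_carrier)
    have sL: "s \<in> ?L" using \<open>s \<in> S\<close> by (blast intro: generate.incl)
    have pL: "?p \<in> ?L"
    proof (rule subgroup_finprod_closed[OF L])
      fix i assume "i \<in> F - {m}"
      then have "x i \<in> ?L" using m(2) by (blast intro: generate.incl)
      then show "x i [^] n i \<in> ?L" using L by (rule subgroup_int_pow_closed[rotated])
    qed
    have Fm: "(\<Otimes>i\<in>F. x i [^] n i) = x m [^] n m \<otimes> ?p"
      using m(1) psubset.hyps x finprod_insert[of "F - {m}" m "\<lambda>i. x i [^] n i"]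
      by (simp add: insert_absorb)
    have "?p \<in> carrier G" using x by simp
    then have "x m [^] n m \<otimes> (s \<otimes> ?p) = \<one>"
      using psubset.prems Fm sc x by (simp add: m_lcomm)
    then have "x m [^] n m = inv (s \<otimes> ?p)"
      using sc x \<open>?p \<in> carrier G\<close> by (intro inv_equality[symmetric]) auto
    then have "x m [^] n m \<in> ?L"
      using subgroup.m_closed[OF L sL pL] subgroup.m_inv_closed[OF L] by simp
    moreover have "x m [^] n m \<in> generate G {x m}"
      using generate_pow[OF x] by blast
    ultimately have xm: "x m [^] n m = \<one>" using step by blast
    then have "s \<otimes> ?p = \<one>"
      using psubset.prems Fm \<open>?p \<in> carrier G\<close> by simp
    then have "\<forall>i\<in>F - {m}. x i [^] n i = \<one>"
      using psubset.IH[of "F - {m}"] m(1) by blast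
    then show ?thesis using xm by blast
  qed simp
qed

text \<open>
  Transfinite recursion along \<open>R\<close>: at stage \<open>i\<close> only \<open>S\<close> and a small number of points have to be
  avoided, and they generate a small subgroup.
\<close>

lemma triangular_choice:
  fixes R :: "(real \<times> real) set"
  assumes R: "wf R" "\<And>i. {j. (j, i) \<in> R} \<prec> (UNIV :: real set)"
    and S: "subgroup S G" "S \<prec> (UNIV :: real set)"
    and U: "\<And>i. U i \<subseteq> carrier G"
    and avoid: "\<And>S' i. subgroup S' G \<Longrightarrow> S' \<prec> (UNIV :: real set) \<Longrightarrow>
                  \<exists>y\<in>U i - {\<one>}. generate G {y} \<inter> S' = {\<one>}"
  obtains x where "\<And>i. x i \<in> U i - {\<one>}"
    and "\<And>i. generate G {x i} \<inter> generate G (S \<union> x ` {j. (j, i) \<in> R}) = {\<one>}"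
proof -
  define P where "P f i y \<longleftrightarrow> y \<in> U i - {\<one>} \<and>
      generate G {y} \<inter> generate G (S \<union> f ` {j. (j, i) \<in> R}) = {\<one>}" for f :: "real \<Rightarrow> 'a" and i y
  have "\<exists>x. \<forall>i. P x i (x i)"
  proof (rule dependent_wf_choice[OF R(1)])
    fix f g :: "real \<Rightarrow> 'a" and i y assume "\<And>j. (j, i) \<in> R \<Longrightarrow> f j = g j"
    then have "f ` {j. (j, i) \<in> R} = g ` {j. (j, i) \<in> R}" by (intro image_cong) auto
    then show "P f i y = P g i y" by (simp add: P_def)
  next
    fix i and f :: "real \<Rightarrow> 'a" assume "\<And>j. (j, i) \<in> R \<Longrightarrow> P f j (f j)"
    then have "f j \<in> carrier G" if "(j, i) \<in> R" for j
      using that U unfolding P_def by blast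
    then have c: "S \<union> f ` {j. (j, i) \<in> R} \<subseteq> carrier G"
      using subgroup.subset[OF S(1)] by blast
    have "f ` {j. (j, i) \<in> R} \<prec> (UNIV :: real set)"
      by (rule lesspoll_trans1[OF image_lepoll R(2)])
    then have "S \<union> f ` {j. (j, i) \<in> R} \<prec> (UNIV :: real set)"
      using S(2) by (intro Un_lesspoll_infinite infinite_UNIV_char_0)
    then have "\<exists>y\<in>U i - {\<one>}. generate G {y} \<inter> generate G (S \<union> f ` {j. (j, i) \<in> R}) = {\<one>}"
      using c by (intro avoid generate_is_subgroup generate_lesspoll_real)
    then show "\<exists>y. P f i y" unfolding P_def by blast
  qed
  then show ?thesis using that unfolding P_def by blast
qed

text \<open>
  An element of \<open>S\<close> that is a product of powers of members yields a relation over \<open>S\<close>, so it is a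
  product of trivial factors.
\<close>

lemma triangular_generate_Int:
  fixes R :: "('i \<times> 'i) set"
  assumes R: "trans R" "total R" and S: "subgroup S G" and x: "\<And>i. x i \<in> carrier G"
    and step: "\<And>i. generate G {x i} \<inter> generate G (S \<union> x ` {j. (j, i) \<in> R}) = {\<one>}"
  shows "S \<inter> generate G (range x) = {\<one>}"
proof -
  have "g = \<one>" if g: "g \<in> S" "g \<in> generate G (range x)" for g
  proof -
    obtain F and n :: "'i \<Rightarrow> int" where F: "finite F" "g = (\<Otimes>i\<in>F. x i [^] n i)"
      using generate_image_finprod[of UNIV x g] x g(2) by blast
    have "inv g \<otimes> (\<Otimes>i\<in>F. x i [^] n i) = \<one>"
      using F(2) subgroup.mem_carrier[OF S g(1)] by simp
    then have "\<forall>i\<in>F. x i [^] n i = \<one>"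
      by (rule triangular_relation_trivial[OF R S x step F(1) subgroup.m_inv_closed[OF S g(1)]])
    then show ?thesis using F(2) by (simp add: finprod_one_eqI)
  qed
  then show ?thesis
    using subgroup.one_closed[OF S] generate.one[of G "range x"] by blast
qed

text \<open>
  Independence is the absence of nontrivial relations over the trivial subgroup. Injectivity, which
  turns relations between elements into relations between indices, needs \<open>x i \<noteq> \<one>\<close>: a repeated
  member would lie both in its own cyclic subgroup and in the one generated earlier.
\<close>

lemma triangular_independent:
  fixes R :: "('i \<times> 'i) set"
  assumes R: "trans R" "total R" and x: "\<And>i. x i \<in> carrier G" "\<And>i. x i \<noteq> \<one>"
    and step: "\<And>i. generate G {x i} \<inter> generate G ({\<one>} \<union> x ` {j. (j, i) \<in> R}) = {\<one>}"
  shows "inj x" "independent_subset G (range x)"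
proof -
  have neq: "x j \<noteq> x i" if "(j, i) \<in> R" for i j
  proof
    assume "x j = x i"
    then have "x i \<in> generate G ({\<one>} \<union> x ` {j. (j, i) \<in> R})"
      using that \<open>x j = x i\<close>[symmetric] by (intro generate.incl) auto
    moreover have "x i \<in> generate G {x i}" by (intro generate.incl) simp
    ultimately show False using step x(2) by blast
  qed
  show inj: "inj x"
    using neq R(2) unfolding inj_def total_on_def by (metis UNIV_I)
  have "\<forall>b\<in>F. b [^] n b = \<one>"
    if F: "finite F" "F \<subseteq> range x" "(\<Otimes>b\<in>F. b [^] n b) = \<one>" for F and n :: "'a \<Rightarrow> int"
  proof -
    obtain I where I: "F = x ` I" using F(2) by (auto simp: subset_image_iff)
    have fin: "finite I" using F(1) inj I by (simp add: finite_image_iff inj_on_subset)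
    have "(\<Otimes>b\<in>F. b [^] n b) = (\<Otimes>i\<in>I. x i [^] n (x i))"
      unfolding I using x(1) inj by (intro finprod_reindex) (auto intro: inj_on_subset)
    then have p: "(\<Otimes>i\<in>I. x i [^] n (x i)) = \<one>" by (rule trans[OF sym F(3)])
    have "\<one> \<otimes> (\<Otimes>i\<in>I. x i [^] n (x i)) = \<one>" unfolding p by simp
    then have "\<forall>i\<in>I. x i [^] n (x i) = \<one>"
      by (rule triangular_relation_trivial[OF R triv_subgroup x(1) step fin singletonI])
    then show ?thesis by (simp add: I)
  qed
  then show "independent_subset G (range x)"
    using x(1) unfolding independent_subset_def by blast
qed

text \<open>
  Otherwise each \<open>x \<in> B - {\<one>}\<close> has a nontrivial power in \<open>S\<close>. Equal powers of distinct elements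
  would form a relation that independence makes trivial, so these powers embed \<open>B - {\<one>}\<close>
  in \<open>S\<close>, which is too small.
\<close>

lemma large_independent_avoids_subgroup:
  assumes B: "independent_subset G B" and S: "subgroup S G" "S \<prec> B" and "infinite B"
  shows "\<exists>x\<in>B - {\<one>}. generate G {x} \<inter> S = {\<one>}"
proof (rule ccontr)
  assume contra: "\<not> ?thesis"
  have Bc: "B \<subseteq> carrier G" using B by (simp add: independent_subset_def)
  have "\<exists>n :: int. x [^] n \<in> S \<and> x [^] n \<noteq> \<one>" if x: "x \<in> B - {\<one>}" for x
  proof -
    have "\<one> \<in> generate G {x} \<inter> S" using subgroup.one_closed[OF S(1)] by (simp add: generate.one)
    then obtain y where "y \<in> generate G {x}" "y \<in> S" "y \<noteq> \<one>" using contra x by blast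
    moreover have "generate G {x} = {x [^] (k :: int) | k. k \<in> UNIV}"
      using Bc x by (intro generate_pow) blast
    ultimately show ?thesis by auto
  qed
  then obtain n :: "'a \<Rightarrow> int"
    where n: "\<And>x. x \<in> B - {\<one>} \<Longrightarrow> x [^] n x \<in> S \<and> x [^] n x \<noteq> \<one>" by metis
  have "inj_on (\<lambda>x. x [^] n x) (B - {\<one>})"
  proof (rule inj_onI, rule ccontr)
    fix x y assume xy: "x \<in> B - {\<one>}" "y \<in> B - {\<one>}" "x [^] n x = y [^] n y" "x \<noteq> y"
    define m where "m = n(y := - n y)"
    have c: "x \<in> carrier G" "y \<in> carrier G" using xy Bc by auto
    have "(\<Otimes>b\<in>{x, y}. b [^] m b) = x [^] n x \<otimes> inv (y [^] n y)"
      using xy(4) c by (simp add: m_def int_pow_neg)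
    then have "(\<Otimes>b\<in>{x, y}. b [^] m b) = \<one>" using xy(3) c by simp
    moreover have "\<And>F (n :: 'a \<Rightarrow> int). finite F \<Longrightarrow> F \<subseteq> B \<Longrightarrow>
        (\<Otimes>b\<in>F. b [^] n b) = \<one> \<Longrightarrow> \<forall>b\<in>F. b [^] n b = \<one>"
      using B by (simp add: independent_subset_def)
    from this[of "{x, y}" m] have "(\<Otimes>b\<in>{x, y}. b [^] m b) = \<one> \<Longrightarrow> x [^] m x = \<one>"
      using xy(1,2) by simp
    ultimately have "x [^] m x = \<one>" by blast
    then show False using n[OF xy(1)] xy(4) by (simp add: m_def)
  qed
  then have "B - {\<one>} \<lesssim> S" using n unfolding lepoll_def by blast
  moreover have "insert \<one> (B - {\<one>}) \<approx> B - {\<one>}"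
    using \<open>infinite B\<close> by (intro infinite_insert_eqpoll) simp
  ultimately have "insert \<one> (B - {\<one>}) \<lesssim> S" by (rule lepoll_trans1[rotated])
  moreover have "B \<lesssim> insert \<one> (B - {\<one>})" by (intro subset_imp_lepoll) blast
  ultimately have "B \<lesssim> S" by (rule lepoll_trans[rotated])
  then have "S \<prec> S" by (rule lesspoll_trans2[OF S(2)])
  then show False by simp
qed

end

section \<open>Dense subgroups of semitopological groups\<close>

definition opens_avoid_small_subgroups :: "('a, 'm) monoid_scheme \<Rightarrow> 'a topology \<Rightarrow> bool" where
  "opens_avoid_small_subgroups G T \<longleftrightarrow>
     (\<forall>S U. subgroup S G \<and> S \<prec> (UNIV :: real set) \<and> openin T U \<and> U \<noteq> {} \<longrightarrow>
        (\<exists>x \<in> U - {\<one>\<^bsub>G\<^esub>}. generate G {x} \<inter> S = {\<one>\<^bsub>G\<^esub>}))"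

context semitopological_group
begin

text \<open>
  Left translations carry the isolated point \<open>\<one>\<close> to every point, and a dense set contains all
  isolated points.
\<close>

lemma dense_eq_carrier_if_open_one:
  assumes "openin T {\<one>}" "dense_in_space T H"
  shows "H = carrier G"
proof
  show "H \<subseteq> carrier G" using assms(2) by (simp add: dense_in_space_def topspace_eq)
  show "carrier G \<subseteq> H"
  proof
    fix g assume g: "g \<in> carrier G"
    have "openin T {y \<in> topspace T. inv g \<otimes> y \<in> {\<one>}}"
      using continuous_left_translation[of "inv g"] g assms(1)
      by (intro openin_continuous_map_preimage) auto
    moreover have "{y \<in> topspace T. inv g \<otimes> y \<in> {\<one>}} = {g}"
      using g by (auto simp: topspace_eq) (metis inv_closed inv_equality inv_inv)
    ultimately have "openin T {g}" by simp
    then have "H \<inter> {g} \<noteq> {}"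
      using assms(2) unfolding dense_in_space_iff by blast
    then show "g \<in> H" by blast
  qed
qed

text \<open>
  The dense subgroup \<open>H\<close> supplied for \<open>S\<close> meets the open set \<open>U - {\<one>}\<close>, unless this is empty. If it is,
  the group is discrete, hence equal to \<open>H\<close> and countable, and \<open>d\<close>-independence can be applied to the
  whole group as the small subgroup; this forces the group to be trivial.
\<close>

lemma d_independent_imp_avoid:
  assumes "Hausdorff_space T" "d_independent G T"
  shows "opens_avoid_small_subgroups G T"
  unfolding opens_avoid_small_subgroups_def
proof clarify
  fix S U assume S: "subgroup S G" "S \<prec> (UNIV :: real set)" and U: "openin T U" "U \<noteq> {}"
  have ex: "\<exists>H. subgroup H G \<and> countable H \<and> dense_in_space T H \<and> S' \<inter> H = {\<one>}"
    if "subgroup S' G" "S' \<prec> (UNIV :: real set)" for S'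
    using assms(2) that unfolding d_independent_def by blast
  obtain H where H: "subgroup H G" "countable H" "dense_in_space T H" "S \<inter> H = {\<one>}"
    using ex[OF S] by blast
  have "U \<noteq> {\<one>}"
  proof
    assume "U = {\<one>}"
    then have all: "H' = carrier G" if "dense_in_space T H'" for H'
      using dense_eq_carrier_if_open_one that U(1) by blast
    then have "carrier G \<prec> (UNIV :: real set)"
      using H(2,3) countable_lesspoll_real by blast
    then have "carrier G \<inter> carrier G = {\<one>}" using ex[OF subgroup_self] all by blast
    then show False using assms(2) by (simp add: d_independent_def)
  qed
  moreover have "openin T (U - {\<one>})"
    using U(1) assms(1) by (intro openin_diff closedin_Hausdorff_singleton) (auto simp: topspace_eq)
  ultimately obtain x where x: "x \<in> H" "x \<in> U - {\<one>}"
    using H(3) U(2) unfolding dense_in_space_iff by blast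
  have "generate G {x} \<subseteq> H" using x(1) H(1) by (intro generate_subgroup_incl) auto
  then have "generate G {x} \<inter> S = {\<one>}"
    using H(4) subgroup.one_closed[OF S(1)] generate.one[of G "{x}"] by blast
  then show "\<exists>x\<in>U - {\<one>}. generate G {x} \<inter> S = {\<one>}" using x(2) by blast
qed

text \<open>
  A countable dense subset of \<open>H\<close> is dense in the whole space, because density is transitive, and it
  generates a countable subgroup inside \<open>H\<close>.
\<close>

lemma dense_subgroup_contains_countable:
  assumes "dense_subgroup_separable G T" "subgroup H G" "dense_in_space T H"
  obtains K where "subgroup K G" "countable K" "dense_in_space T K" "K \<subseteq> H"
proof -
  have Hc: "H \<subseteq> topspace T" using assms(3) by (simp add: dense_in_space_def)
  have "separable_space (subtopology T H)"
    using assms unfolding dense_subgroup_separable_def by blast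
  then obtain D where D: "countable D" "D \<subseteq> H" "subtopology T H closure_of D = topspace (subtopology T H)"
    unfolding separable_space_def using Hc by (auto simp: inf.absorb2)
  have DH: "D \<subseteq> carrier G" using D(2) Hc by (simp add: topspace_eq)
  have sub: "generate G D \<subseteq> H" using D(2) assms(2) by (rule generate_subgroup_incl)
  have "generate G D \<inter> U \<noteq> {}" if U: "openin T U" "U \<noteq> {}" for U
  proof -
    have "H \<inter> U \<noteq> {}"
      using assms(3) U unfolding dense_in_space_iff by blast
    moreover have "openin (subtopology T H) (H \<inter> U)" using U(1) by (rule openin_subtopology_Int2)
    ultimately have "D \<inter> (H \<inter> U) \<noteq> {}"
      using D(3) unfolding dense_intersects_open by blast
    then show ?thesis by (blast intro: generate.incl)
  qed
  then have "dense_in_space T (generate G D)"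
    using sub Hc unfolding dense_in_space_iff by blast
  then show ?thesis
    using that generate_is_subgroup[OF DH] countable_generate[OF DH D(1)] sub by blast
qed

lemma avoid_imp_not_trivial:
  assumes "opens_avoid_small_subgroups G T"
  shows "carrier G \<noteq> {\<one>}"
proof -
  have "openin T (carrier G)" using topspace_eq by (metis openin_topspace)
  moreover have "{\<one>} \<prec> (UNIV :: real set)" by (intro countable_lesspoll_real) simp
  ultimately obtain x where "x \<in> carrier G - {\<one>}"
    using assms triv_subgroup one_closed unfolding opens_avoid_small_subgroups_def by blast
  then show ?thesis by blast
qed

text \<open>
  This is \<open>triangular_choice\<close> along the well-order of the reals, with well-foundedness forgotten:
  once the points are chosen, only the linear order of their indices matters.
\<close>

lemma avoid_imp_triangular:
  assumes "comm_group G" "opens_avoid_small_subgroups G T"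
    and S: "subgroup S G" "S \<prec> (UNIV :: real set)"
    and V: "\<And>i :: real. openin T (V i)" "\<And>i. V i \<noteq> {}"
  obtains R and x :: "real \<Rightarrow> 'a"
  where "trans R" "total R" "\<And>i. x i \<in> V i" "\<And>i. x i \<in> carrier G" "\<And>i. x i \<noteq> \<one>"
    and "\<And>i. generate G {x i} \<inter> generate G (S \<union> x ` {j. (j, i) \<in> R}) = {\<one>}"
proof -
  interpret comm_group G by fact
  obtain R :: "(real \<times> real) set" where R: "wf R" "trans R" "total R"
    "\<And>i. {j. (j, i) \<in> R} \<prec> (UNIV :: real set)"
    by (rule real_wellorder_small_segments) (rule that)
  have Vc: "V i \<subseteq> carrier G" for i using openin_subset[OF V(1)] by (simp add: topspace_eq)
  have avoid: "\<exists>y\<in>V i - {\<one>}. generate G {y} \<inter> S' = {\<one>}"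
    if "subgroup S' G" "S' \<prec> (UNIV :: real set)" for S' i
    using assms(2)[unfolded opens_avoid_small_subgroups_def, rule_format, of S' "V i"] that V
    by simp
  obtain x where x: "\<And>i. x i \<in> V i - {\<one>}"
    "\<And>i. generate G {x i} \<inter> generate G (S \<union> x ` {j. (j, i) \<in> R}) = {\<one>}"
    by (rule triangular_choice[OF R(1,4) S Vc]) (erule (1) avoid, rule that)
  have "x i \<in> V i" "x i \<in> carrier G" "x i \<noteq> \<one>" for i
    using x(1)[of i] Vc[of i] by auto
  then show ?thesis by (rule that[OF R(2,3) _ _ _ x(2)])
qed

text \<open>
  With the \<open>V i\<close> forming a \<open>\<pi>\<close>-base, the chosen points generate a dense subgroup. It need not be
  countable; dense-subgroup-separability shrinks it to a countable one, and shrinking preserves the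
  trivial intersection with \<open>S\<close>.
\<close>

lemma avoid_imp_d_independent:
  assumes "comm_group G" "regular_space T" "dense_subgroup_separable G T"
    and avoid: "opens_avoid_small_subgroups G T"
  shows "d_independent G T"
  unfolding d_independent_def
proof (intro conjI allI impI)
  interpret comm_group G by fact
  show "carrier G \<noteq> {\<one>}" using avoid by (rule avoid_imp_not_trivial)
  fix S assume S: "subgroup S G \<and> S \<prec> (UNIV :: real set)"
  have "dense_in_space T (carrier G)"
    by (simp add: dense_in_space_def flip: topspace_eq)
  then have "separable_space (subtopology T (carrier G))"
    using assms(3) subgroup_self unfolding dense_subgroup_separable_def by blast
  then have "separable_space T" by (simp flip: topspace_eq)
  moreover have "topspace T \<noteq> {}" using topspace_eq one_closed by blast
  ultimately obtain V :: "real \<Rightarrow> 'a set"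
    where V: "\<And>i. openin T (V i)" "\<And>i. V i \<noteq> {}"
      and base: "\<And>U. openin T U \<Longrightarrow> U \<noteq> {} \<Longrightarrow> \<exists>i. V i \<subseteq> U"
    by (rule regular_separable_pi_base[OF assms(2)]) (rule that)
  obtain R and x :: "real \<Rightarrow> 'a" where R: "trans R" "total R"
    and x: "\<And>i. x i \<in> V i" "\<And>i. x i \<in> carrier G"
    and step: "\<And>i. generate G {x i} \<inter> generate G (S \<union> x ` {j. (j, i) \<in> R}) = {\<one>}"
    by (rule avoid_imp_triangular[OF assms(1) avoid conjunct1[OF S] conjunct2[OF S] V]) (rule that)
  let ?H = "generate G (range x)"
  have H: "subgroup ?H G" using x(2) by (intro generate_is_subgroup) blast
  have "?H \<inter> U \<noteq> {}" if U: "openin T U" "U \<noteq> {}" for U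
  proof -
    obtain i where "V i \<subseteq> U" using base[OF U] by blast
    moreover have "x i \<in> ?H" by (intro generate.incl) simp
    ultimately show ?thesis using x(1) by blast
  qed
  then have "dense_in_space T ?H"
    using subgroup.subset[OF H] by (simp add: dense_in_space_iff topspace_eq)
  then obtain K where K: "subgroup K G" "countable K" "dense_in_space T K" "K \<subseteq> ?H"
    by (rule dense_subgroup_contains_countable[OF assms(3) H]) (rule that)
  have "S \<inter> ?H = {\<one>}"
    using S by (intro triangular_generate_Int[OF R _ x(2) step]) blast
  then have "S \<inter> K = {\<one>}"
    using K(4) subgroup.one_closed[OF K(1)] by blast
  then show "\<exists>H. subgroup H G \<and> countable H \<and> dense_in_space T H \<and> S \<inter> H = {\<one>}"
    using K by blast
qed

lemma avoid_imp_large_independent: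
  assumes "comm_group G" and avoid: "opens_avoid_small_subgroups G T"
    and U: "openin T U" "U \<noteq> {}"
  shows "\<exists>B\<subseteq>U. independent_subset G B \<and> B \<approx> (UNIV :: real set)"
proof -
  interpret comm_group G by fact
  have small: "{\<one>} \<prec> (UNIV :: real set)" by (intro countable_lesspoll_real) simp
  obtain R and x :: "real \<Rightarrow> 'a" where R: "trans R" "total R"
    and x: "\<And>i. x i \<in> U" "\<And>i. x i \<in> carrier G" "\<And>i. x i \<noteq> \<one>"
    and step: "\<And>i. generate G {x i} \<inter> generate G ({\<one>} \<union> x ` {j. (j, i) \<in> R}) = {\<one>}"
    by (rule avoid_imp_triangular[OF assms(1) avoid triv_subgroup small U]) (rule that)
  note ind = triangular_independent[OF R x(2,3) step]
  have "range x \<approx> (UNIV :: real set)" using ind(1) by (rule inj_on_image_eqpoll_self)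
  then show ?thesis using ind(2) x(1) by (intro exI[of _ "range x"]) auto
qed

lemma large_independent_imp_avoid:
  assumes "comm_group G"
    and B: "\<And>U. openin T U \<Longrightarrow> U \<noteq> {} \<Longrightarrow>
              \<exists>B\<subseteq>U. independent_subset G B \<and> B \<approx> (UNIV :: real set)"
  shows "opens_avoid_small_subgroups G T"
  unfolding opens_avoid_small_subgroups_def
proof (intro allI impI, elim conjE)
  interpret comm_group G by fact
  fix S U assume S: "subgroup S G" "S \<prec> (UNIV :: real set)" and U: "openin T U" "U \<noteq> {}"
  obtain B where B: "B \<subseteq> U" "independent_subset G B" "B \<approx> (UNIV :: real set)"
    using B[OF U] by blast
  have "S \<prec> B" using S(2) eqpoll_sym[OF B(3)] by (rule lesspoll_eq_trans)
  moreover have "infinite B" using eqpoll_finite_iff[OF B(3)] infinite_UNIV_char_0 by blast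
  ultimately show "\<exists>x\<in>U - {\<one>}. generate G {x} \<inter> S = {\<one>}"
    using large_independent_avoids_subgroup[OF B(2) S(1)] B(1) by blast
qed

end

theorem theorem4p15:
  fixes G :: "('a, 'm) monoid_scheme" and T :: "'a topology"
  assumes "comm_group G"
    and "semitopological_group G T"
    and "Hausdorff_space T"
    and "regular_space T"
    and "dense_subgroup_separable G T"
  shows "(d_independent G T \<longleftrightarrow>
           (\<forall>S U. subgroup S G \<and> S \<prec> (UNIV :: real set) \<and> openin T U \<and> U \<noteq> {} \<longrightarrow>
              (\<exists>x \<in> U - {\<one>\<^bsub>G\<^esub>}. generate G {x} \<inter> S = {\<one>\<^bsub>G\<^esub>}))) \<and>
         (d_independent G T \<longleftrightarrow>
           (\<forall>U. openin T U \<and> U \<noteq> {} \<longrightarrow>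
              (\<exists>B \<subseteq> U. independent_subset G B \<and> B \<approx> (UNIV :: real set))))"
proof -
  interpret semitopological_group G T by fact
  have 12: "d_independent G T \<longleftrightarrow> opens_avoid_small_subgroups G T"
    using d_independent_imp_avoid[OF assms(3)] avoid_imp_d_independent[OF assms(1,4,5)] by blast
  have 23: "opens_avoid_small_subgroups G T \<longleftrightarrow>
      (\<forall>U. openin T U \<and> U \<noteq> {} \<longrightarrow>
         (\<exists>B \<subseteq> U. independent_subset G B \<and> B \<approx> (UNIV :: real set)))"
    using avoid_imp_large_independent[OF assms(1)] large_independent_imp_avoid[OF assms(1)] by blast
  show ?thesis
    by (rule conjI[OF 12[unfolded opens_avoid_small_subgroups_def] trans[OF 12 23]])
qed

end
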